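(* Let $r\geq 2$ be a positive integer. Let $q\equiv 1\pmod{r}$ be a prime power such that $q>r^4$. Let $k\in\mathbb{F}_q^*$ be such that $-k$ is not an $r$-th power in $\mathbb{F}_q^*$. Let $m=\frac{q-1}{r}$. Then for each integer $\ell\geq 1$, the plane curve $C$ over $\mathbb{F}_q$ defined by $$ -(ky^{\ell}+z^{\ell})x^m + z^{\ell} y^m + k y^{\ell} z^m =0 $$ is geometrically irreducible and nontrivially blocking.
   Context: A plane curve $C=\{F=0\}\subset\mathbb{P}^2$ over $\mathbb{F}_q$ is given by a nonzero homogeneous polynomial $F\in\mathbb{F}_q[x,y,z]$; it is geometrically irreducible if $F$ is irreducible in $\overline{\mathbb{F}_q}[x,y,z]$. $C(\mathbb{F}_q)$ is the set of points $[x:y:z]\in\mathbb{P}^2(\mathbb{F}_q)$ with $F(x,y,z)=0$. A set $B\subseteq\mathbb{P}^2(\mathbb{F}_q)$ is a blocking set if every line of $\mathbb{P}^2$ defined over $\mathbb{F}_q$ (an $\mathbb{F}_q$-line) contains a point of $B$; it is a nontrivial blocking set if moreover it does not contain all the $\mathbb{F}_q$-points of any $\mathbb{F}_q$-line. The curve $C$ is nontrivially blocking if $C(\mathbb{F}_q)$ is a nontrivial blocking set. *)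

theory Defs
  imports
    "HOL-Algebra.Algebraic_Closure_Type"
    "HOL-Computational_Algebra.Computational_Algebra"
    "HOL-Number_Theory.Cong"
    "HOL-Library.Cardinality"
begin

text \<open>
  The polynomial ring $K[x,y,z]$ is rendered as $K[z][y][x]$: the outermost variable is $x$,
  the innermost one is $z$. The coefficient of $x^i y^j z^k$ in \<open>F\<close> is therefore
  \<open>coeff (coeff (coeff F i) j) k\<close>.
\<close>

type_synonym 'a poly3 = "'a poly poly poly"

definition const3 :: "'a::comm_semiring_1 \<Rightarrow> 'a poly3" where
  "const3 c = [:[:[:c:]:]:]"

definition X3 :: "'a::comm_semiring_1 poly3" where
  "X3 = [:0, 1:]"

definition Y3 :: "'a::comm_semiring_1 poly3" where
  "Y3 = [:[:0, 1:]:]"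

definition Z3 :: "'a::comm_semiring_1 poly3" where
  "Z3 = [:[:[:0, 1:]:]:]"

definition eval3 :: "'a::comm_semiring_1 poly3 \<Rightarrow> 'a \<Rightarrow> 'a \<Rightarrow> 'a \<Rightarrow> 'a" where
  "eval3 F x y z = poly (poly (poly F [:[:x:]:]) [:y:]) z"

definition map_poly3 :: "('a::zero \<Rightarrow> 'b::zero) \<Rightarrow> 'a poly3 \<Rightarrow> 'b poly3" where
  "map_poly3 f = map_poly (map_poly (map_poly f))"

definition homogeneous3 :: "'a::zero poly3 \<Rightarrow> bool" where
  "homogeneous3 F \<longleftrightarrow>
     (\<exists>d. \<forall>i j k. coeff (coeff (coeff F i) j) k \<noteq> 0 \<longrightarrow> i + j + k = d)"

definition plane_curve :: "'a::zero poly3 \<Rightarrow> bool" where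
  "plane_curve F \<longleftrightarrow> F \<noteq> 0 \<and> homogeneous3 F"

text \<open>
  Irreducibility is that of ring elements (neither zero nor a unit, no proper factorization);
  HOL-Algebra declares a locale-based constant with the same base name.
\<close>

definition geometrically_irreducible :: "'a::field poly3 \<Rightarrow> bool" where
  "geometrically_irreducible F \<longleftrightarrow> Factorial_Ring.irreducible (map_poly3 to_ac F)"

text \<open>
  Points of the projective plane over the field \<open>'a\<close> are the classes of nonzero triples up to
  nonzero scalars.
\<close>

definition proj_rel :: "(('a::field \<times> 'a \<times> 'a) \<times> ('a \<times> 'a \<times> 'a)) set" where
  "proj_rel = {((x, y, z), (x', y', z')).
     (x, y, z) \<noteq> (0, 0, 0) \<and> (\<exists>c. c \<noteq> 0 \<and> x' = c * x \<and> y' = c * y \<and> z' = c * z)}"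

type_synonym 'a proj_point = "('a \<times> 'a \<times> 'a) set"

definition proj_plane :: "'a::field proj_point set" where
  "proj_plane = (UNIV - {(0, 0, 0)}) // proj_rel"

definition proj_pt :: "'a::field \<Rightarrow> 'a \<Rightarrow> 'a \<Rightarrow> 'a proj_point" where
  "proj_pt x y z = proj_rel `` {(x, y, z)}"

definition proj_line :: "'a::field \<Rightarrow> 'a \<Rightarrow> 'a \<Rightarrow> 'a proj_point set" where
  "proj_line a b c =
     {proj_pt x y z | x y z. (x, y, z) \<noteq> (0, 0, 0) \<and> a * x + b * y + c * z = 0}"

definition proj_lines :: "'a::field proj_point set set" where
  "proj_lines = {proj_line a b c | a b c. (a, b, c) \<noteq> (0, 0, 0)}"

definition blocking_set :: "'a::field proj_point set \<Rightarrow> bool" where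
  "blocking_set B \<longleftrightarrow> B \<subseteq> proj_plane \<and> (\<forall>L\<in>proj_lines. L \<inter> B \<noteq> {})"

definition nontrivial_blocking_set :: "'a::field proj_point set \<Rightarrow> bool" where
  "nontrivial_blocking_set B \<longleftrightarrow> blocking_set B \<and> (\<forall>L\<in>proj_lines. \<not> L \<subseteq> B)"

definition rational_points :: "'a::field poly3 \<Rightarrow> 'a proj_point set" where
  "rational_points F = {proj_pt x y z | x y z. (x, y, z) \<noteq> (0, 0, 0) \<and> eval3 F x y z = 0}"

definition nontrivially_blocking :: "'a::field poly3 \<Rightarrow> bool" where
  "nontrivially_blocking F \<longleftrightarrow> nontrivial_blocking_set (rational_points F)"

end

(*
  Let S be the group of m-th roots of unity of the field, which is the group of nonzero r-th powers.

  Points with coordinates in S lie on the curve, and so do the coordinate points. For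
  a line a x + b y + c z = 0 with abc nonzero, a solution in S exists by a second moment argument:
  the number of representations of v as s + h t with s, t in S has, over all slopes h and all v, total
  variance m^2 (q - m)^2 / q, which is too small for a whole class of pairs (h, v) without
  representations when q > r^4. A line contained in the curve could only be b y + c z = 0 with
  bc nonzero, and then its points with x = 0 and x = 1 would make -k an l-th power of an element of S.

  For irreducibility, view the form as the binomial A x^m + B with A = -(k y^l + z^l). For a root
  w of k w^l = -1, the factor y - w z has multiplicity a power of the characteristic in A, which is
  prime to m, and it does not divide B because -k is not an r-th power. Dumas' criterion makes
  A x^m + B irreducible up to common factors of A and B, of which there are none for the same reason.
*)
theory Submission
  imports Defs "HOL-Number_Theory.Residues"
begin

section \<open>Roots of unity in a finite field\<close>

lemma card_power_eq_le:
  fixes c :: "'a::idom"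
  assumes "n > 0"
  shows "card {x. x ^ n = c} \<le> n" "finite {x. x ^ n = c}"
proof -
  define p where "p = monom 1 n + [:- c:]"
  have deg: "degree p = n"
    unfolding p_def using assms by (subst degree_add_eq_left) (auto simp: degree_monom_eq)
  hence "p \<noteq> 0" using assms by auto
  moreover have "{x. poly p x = 0} = {x. x ^ n = c}"
    by (auto simp: p_def poly_monom)
  ultimately show "card {x. x ^ n = c} \<le> n" "finite {x. x ^ n = c}"
    using card_poly_roots_bound[of p] poly_roots_finite[of p] deg by auto
qed

lemma nonzero_power_card_minus_1:
  fixes x :: "'a::finite_field"
  assumes "x \<noteq> 0"
  shows "x ^ (CARD('a) - 1) = 1"
proof -
  have "x * x ^ (CARD('a) - 1) = x ^ CARD('a)"
    by (metis power_minus_mult mult.commute zero_less_card_finite)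
  thus ?thesis using assms finite_field_power_card_eq_same[of x] by simp
qed

text \<open>Double counting: the fibres of \<open>u \<mapsto> u ^ r\<close> on the
  \<open>m * r\<close> nonzero elements have at most \<open>r\<close> elements, so there are at
  least \<open>m\<close> nonzero \<open>r\<close>-th powers. All of them are \<open>m\<close>-th
  roots of unity, of which there are at most \<open>m\<close>, so equality holds throughout.\<close>

lemma roots_of_unity_finite_field:
  fixes m r :: nat
  assumes mr: "m * r = CARD('a::finite_field) - 1" and "m > 0" "r > 0"
  shows "card {x::'a. x ^ m = 1} = m" (is "card ?S = m")
    and "{x::'a. x ^ m = 1} = (\<lambda>u. u ^ r) ` (UNIV - {0})"
proof -
  let ?U = "UNIV - {0 :: 'a}" and ?I = "(\<lambda>u. u ^ r) ` (UNIV - {0 :: 'a})"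
  have sub: "?I \<subseteq> ?S"
    using nonzero_power_card_minus_1[where ?'a = 'a] mr
    by (auto simp: mult.commute simp flip: power_mult)
  have "m * r = card ?U" using mr by simp
  also have "\<dots> \<le> card (\<Union>y\<in>?I. {u::'a. u ^ r = y})"
    by (intro card_mono) auto
  also have "\<dots> \<le> (\<Sum>y\<in>?I. card {u::'a. u ^ r = y})"
    by (rule card_UN_le) auto
  also have "\<dots> \<le> (\<Sum>y\<in>?I. r)"
    using assms by (intro sum_mono card_power_eq_le)
  finally have "m \<le> card ?I" using \<open>r > 0\<close> by simp
  moreover have "card ?I \<le> card ?S" by (intro card_mono sub) auto
  moreover have "card ?S \<le> m" using card_power_eq_le \<open>m > 0\<close> by blast
  ultimately show "card ?S = m" "?S = ?I"
    using card_subset_eq[OF _ sub] by auto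
qed

section \<open>Zeros of linear forms in a multiplicative subgroup, by second moments\<close>

text \<open>For fixed \<open>h\<close> the values \<open>N h c\<close> sum to
  \<open>m\<^sup>2\<close>, so their mean is \<open>m\<^sup>2 / q\<close>. Their squares count
  quadruples with \<open>s + h * t = s' + h * t'\<close>, and summing over the nonzero slopes counts
  these exactly.\<close>

lemma representations_variance:
  fixes S :: "'a::finite_field set"
  defines "q \<equiv> real CARD('a)" and "m \<equiv> real (card S)"
  defines "N \<equiv> \<lambda>h c. \<Sum>s\<in>S. \<Sum>t\<in>S. of_bool (s + h * t = c)"
  shows "(\<Sum>h\<in>UNIV - {0}. \<Sum>c\<in>UNIV. (N h c - m\<^sup>2 / q)\<^sup>2) = m\<^sup>2 * (q - m)\<^sup>2 / q"
proof -
  let ?U = "UNIV - {0::'a}"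
  define \<mu> where "\<mu> = m\<^sup>2 / q"
  have q: "q > 0" by (simp add: q_def)
  have cardU: "real (card ?U) = q - 1"
    by (simp add: q_def of_nat_diff Suc_leI)
  have bool_sum: "(\<Sum>c\<in>UNIV. of_bool (a = c) :: real) = 1" for a :: 'a
    by (simp add: of_bool_def)
  have sumN: "(\<Sum>c\<in>UNIV. N h c) = m\<^sup>2" for h
  proof -
    have "(\<Sum>c\<in>UNIV. N h c) = (\<Sum>s\<in>S. \<Sum>t\<in>S. \<Sum>c\<in>UNIV. of_bool (s + h * t = c))"
      unfolding N_def by (subst sum.swap, subst (2) sum.swap) (rule refl)
    thus ?thesis by (simp add: bool_sum m_def power2_eq_square)
  qed
  have sumN2: "(\<Sum>c\<in>UNIV. (N h c)\<^sup>2)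
      = (\<Sum>s\<in>S. \<Sum>t\<in>S. \<Sum>s'\<in>S. \<Sum>t'\<in>S. of_bool (s + h * t = s' + h * t'))" for h
  proof -
    have "(\<Sum>c\<in>UNIV. (N h c)\<^sup>2) = (\<Sum>c\<in>UNIV. \<Sum>s\<in>S. \<Sum>t\<in>S. of_bool (s + h * t = c) * N h c)"
      by (simp add: N_def power2_eq_square sum_distrib_right)
    also have "\<dots> = (\<Sum>s\<in>S. \<Sum>t\<in>S. \<Sum>c\<in>UNIV. of_bool (s + h * t = c) * N h c)"
      by (subst sum.swap, subst (2) sum.swap) (rule refl)
    also have "\<dots> = (\<Sum>s\<in>S. \<Sum>t\<in>S. N h (s + h * t))"
      by (simp add: of_bool_def if_distrib[of "\<lambda>x. x * _"] cong: if_cong)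
    finally show ?thesis by (simp add: N_def eq_commute)
  qed
  \<comment> \<open>Equal pairs collide for all \<open>q - 1\<close> slopes. If
    \<open>t' \<noteq> t\<close>, the only possible slope is \<open>(s - s') / (t' - t)\<close>,
    which is nonzero exactly when \<open>s' \<noteq> s\<close>.\<close>
  have slopes: "(\<Sum>h\<in>?U. of_bool (s + h * t = s' + h * t') :: real)
      = (if t' = t then (if s' = s then q - 1 else 0) else (if s' = s then 0 else 1))" for s t s' t' :: 'a
  proof (cases "t' = t")
    case True
    thus ?thesis using cardU by auto
  next
    case False
    have eq: "s + h * t = s' + h * t' \<longleftrightarrow> (s - s') / (t' - t) = h" for h
      using False by (auto simp: field_simps)
    have "(\<Sum>h\<in>?U. of_bool (s + h * t = s' + h * t') :: real)
        = of_bool ((s - s') / (t' - t) \<in> ?U)"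
      unfolding eq by (simp add: of_bool_def)
    thus ?thesis using False by auto
  qed
  have second: "(\<Sum>h\<in>?U. \<Sum>c\<in>UNIV. (N h c)\<^sup>2) = m\<^sup>2 * ((q - 1) + (m - 1)\<^sup>2)"
  proof -
    have "(\<Sum>h\<in>?U. \<Sum>c\<in>UNIV. (N h c)\<^sup>2)
       = (\<Sum>s\<in>S. \<Sum>t\<in>S. \<Sum>s'\<in>S. \<Sum>t'\<in>S. \<Sum>h\<in>?U. of_bool (s + h * t = s' + h * t'))"
      unfolding sumN2
      by (subst sum.swap, subst (2) sum.swap, subst (3) sum.swap, subst (4) sum.swap) (rule refl)
    also have "\<dots> = (\<Sum>s\<in>S. \<Sum>t\<in>S. (q - 1) + (m - 1)\<^sup>2)"
    proof (intro sum.cong refl)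
      fix s t assume st: "s \<in> S" "t \<in> S"
      have m1: "real (card (S - {x})) = m - 1" if "x \<in> S" for x
        using card.remove[OF _ that] by (simp add: m_def)
      have "(\<Sum>s'\<in>S. \<Sum>t'\<in>S. \<Sum>h\<in>?U. of_bool (s + h * t = s' + h * t') :: real)
          = (\<Sum>s'\<in>S. if s' = s then q - 1 else m - 1)"
        unfolding slopes
      proof (intro sum.cong refl)
        fix s' assume "s' \<in> S"
        show "(\<Sum>t'\<in>S. if t' = t then (if s' = s then q - 1 else 0) else (if s' = s then 0 else 1))
          = (if s' = s then q - 1 else m - 1)"
          using st by (simp add: sum.remove[of S t] m1 del: card_Diff_insert card_Diff_singleton)
      qed
      also have "\<dots> = (q - 1) + (m - 1)\<^sup>2"
        using st by (simp add: sum.remove[of S s] m1 power2_eq_square del: card_Diff_insert card_Diff_singleton)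
      finally show "(\<Sum>s'\<in>S. \<Sum>t'\<in>S. \<Sum>h\<in>?U. of_bool (s + h * t = s' + h * t') :: real)
          = (q - 1) + (m - 1)\<^sup>2" .
    qed
    finally show ?thesis by (simp add: m_def power2_eq_square)
  qed
  have "(\<Sum>h\<in>?U. \<Sum>c\<in>UNIV. (N h c - \<mu>)\<^sup>2)
      = (\<Sum>h\<in>?U. (\<Sum>c\<in>UNIV. (N h c)\<^sup>2) - 2 * \<mu> * (\<Sum>c\<in>UNIV. N h c) + q * \<mu>\<^sup>2)"
    by (simp add: power2_diff sum.distrib sum_subtractf sum_distrib_left q_def mult_ac)
  also have "\<dots> = m\<^sup>2 * ((q - 1) + (m - 1)\<^sup>2) + (q - 1) * (q * \<mu>\<^sup>2 - 2 * \<mu> * m\<^sup>2)"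
    using cardU by (simp add: sumN sum.distrib sum_subtractf second algebra_simps)
  also have "\<dots> = m\<^sup>2 * (q - m)\<^sup>2 / q"
    unfolding \<mu>_def using q by (simp add: field_simps power2_eq_square)
  finally show ?thesis unfolding \<mu>_def .
qed

text \<open>
  Rescaling the summands by \<open>S\<close> shows that an unattained value of \<open>s + h t\<close> on \<open>S \<times> S\<close> comes
  with \<open>(card S)\<^sup>2\<close> pairs of a slope and an unattained value.
\<close>

lemma diagonal_form_zero_in_subsemigroup:
  fixes S :: "'a::finite_field set"
  assumes mult: "\<And>s t. s \<in> S \<Longrightarrow> t \<in> S \<Longrightarrow> s * t \<in> S"
    and zero: "0 \<notin> S"
    and large: "real CARD('a) * (real CARD('a) - real (card S))\<^sup>2 < real (card S) ^ 4"
    and abc: "a \<noteq> 0" "b \<noteq> 0" "c \<noteq> 0"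
  shows "\<exists>s\<in>S. \<exists>t\<in>S. \<exists>w\<in>S. a * s + b * t + c * w = 0"
proof (rule ccontr)
  assume neg: "\<not> ?thesis"
  define q m where "q = real CARD('a)" and "m = real (card S)"
  define N :: "'a \<Rightarrow> 'a \<Rightarrow> real"
    where "N = (\<lambda>h c. \<Sum>s\<in>S. \<Sum>t\<in>S. of_bool (s + h * t = c))"
  define V where "V = (\<Sum>p\<in>(UNIV - {0}) \<times> UNIV. (N (fst p) (snd p) - m\<^sup>2 / q)\<^sup>2)"
  \<comment> \<open>If the value \<open>- c / a * v\<close> were represented with slope
    \<open>b / a * u\<close>, then clearing \<open>a\<close> would give the forbidden zero with
    coordinates \<open>s\<close>, \<open>u * t\<close> and \<open>v\<close>, all in
    \<open>S\<close>.\<close>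
  define f where "f = (\<lambda>(u, v). (b / a * u, - c / a * v))"
  have q: "q > 0" by (simp add: q_def)
  have "0 \<le> real CARD('a) * (real CARD('a) - real (card S))\<^sup>2" by simp
  with large have "0 < real (card S) ^ 4" by linarith
  hence "m \<noteq> 0" by (auto simp: m_def)
  hence m: "m > 0" unfolding m_def by (metis neq0_conv of_nat_0 of_nat_0_less_iff)
  have inj: "inj_on f (S \<times> S)" using abc by (auto simp: inj_on_def f_def)
  have N0: "N (fst (f p)) (snd (f p)) = 0" if pS: "p \<in> S \<times> S" for p
  proof -
    obtain u v where p: "p = (u, v)" "u \<in> S" "v \<in> S" using pS by auto
    have "s + b / a * u * t \<noteq> - c / a * v" if "s \<in> S" "t \<in> S" for s t
    proof
      assume "s + b / a * u * t = - c / a * v"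
      moreover have "a * s + b * (u * t) + c * v = a * (s + b / a * u * t - (- c / a * v))"
        using abc by (simp add: algebra_simps)
      ultimately have "a * s + b * (u * t) + c * v = 0" by simp
      with neg mult that p show False by blast
    qed
    hence "of_bool (s + fst (f p) * t = snd (f p)) = (0 :: real)" if "s \<in> S" "t \<in> S" for s t
      using that by (simp add: p f_def)
    thus ?thesis unfolding N_def by (intro sum.neutral ballI)
  qed
  \<comment> \<open>Each of the \<open>m\<^sup>2\<close> pairs in the image of \<open>f\<close>
    deviates from the mean by the full \<open>m\<^sup>2 / q\<close>.\<close>
  have "m\<^sup>2 * (m\<^sup>2 / q)\<^sup>2 = (\<Sum>p\<in>f ` (S \<times> S). (N (fst p) (snd p) - m\<^sup>2 / q)\<^sup>2)"
    by (subst sum.reindex[OF inj]) (simp add: N0 m_def card_cartesian_product power2_eq_square)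
  also have "\<dots> \<le> V"
    unfolding V_def using zero abc by (intro sum_mono2) (auto simp: f_def)
  also have "V = m\<^sup>2 * (q - m)\<^sup>2 / q"
    unfolding V_def using representations_variance[of S]
    by (simp add: sum.cartesian_product' N_def q_def m_def)
  finally have "m\<^sup>2 * m ^ 4 \<le> m\<^sup>2 * (q * (q - m)\<^sup>2)"
    using q by (simp add: field_simps power2_eq_square power4_eq_xxxx)
  hence "m ^ 4 \<le> q * (q - m)\<^sup>2"
    by (rule mult_left_le_imp_le) (use m in simp)
  with large show False by (simp add: q_def m_def)
qed

text \<open>From \<open>r ^ 4 \<le> m * r\<close> follows \<open>r ^ 3 \<le> m\<close>. With
  \<open>u = m * r = q - 1\<close>, the left side is at most \<open>(u + 1) * (u - 1)\<^sup>2 < u ^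
  3 = m ^ 3 * r ^ 3 \<le> m ^ 4\<close>.\<close>

lemma subgroup_size_estimate:
  fixes r m q :: nat
  assumes "r \<ge> 2" "q = m * r + 1" "q > r ^ 4"
  shows "real q * (real q - real m)\<^sup>2 < real m ^ 4"
proof -
  have "r ^ 4 \<le> r * m" using assms by (simp add: mult.commute)
  hence "r * r ^ 3 \<le> r * m" by (simp add: power4_eq_xxxx power3_eq_cube mult.assoc)
  hence "r ^ 3 \<le> m" using assms by simp
  moreover have "2 ^ 3 \<le> r ^ 3" using assms by (intro power_mono) auto
  ultimately have m: "real r ^ 3 \<le> m" "real m \<ge> 2"
    by (simp_all flip: of_nat_power)
  define u where "u = real m * real r"
  have u: "u \<ge> 2 * real m" using assms by (simp add: u_def mult_mono mult.commute)
  have "real q * (real q - real m)\<^sup>2 = (u + 1) * (u - (real m - 1))\<^sup>2"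
    using assms by (simp add: u_def algebra_simps)
  also have "\<dots> \<le> (u + 1) * (u - 1)\<^sup>2"
    using u m by (intro mult_left_mono power_mono) auto
  also have "\<dots> = u ^ 3 - u ^ 2 - u + 1" by (simp add: power2_eq_square power3_eq_cube algebra_simps)
  also have "\<dots> < u ^ 3" using u m zero_le_power2[of u] by linarith
  also have "u ^ 3 = real m ^ 3 * real r ^ 3" by (simp add: u_def power_mult_distrib)
  also have "\<dots> \<le> real m ^ 3 * real m" using m by (intro mult_left_mono) auto
  finally show ?thesis by (simp add: power4_eq_xxxx power3_eq_cube mult_ac)
qed

section \<open>Irreducibility of binomials from the order at a root\<close>

text \<open>Split off the full power \<open>P\<close> of the characteristic from \<open>l\<close>,
  so that \<open>l = P * l'\<close>. By Frobenius the polynomial is the \<open>P\<close>-th power of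
  \<open>D\<close>, which has a simple root at \<open>b\<close> because its derivative there is
  \<open>l' * b ^ (l' - 1) \<noteq> 0\<close>.\<close>

lemma order_power_minus_power:
  fixes b :: "'a::idom"
  assumes p: "prime CHAR('a)" and "l > 0" "b \<noteq> 0"
  shows "\<exists>n. order b (monom 1 l - [:b ^ l:]) = CHAR('a) ^ n"
proof -
  define p where "p = CHAR('a)"
  obtain l' where l': "l = p ^ multiplicity p l * l'" "\<not> p dvd l'"
    using multiplicity_decompose'[of l p] \<open>l > 0\<close> p by (auto simp: p_def prime_nat_iff)
  define P where "P = p ^ multiplicity p l"
  have "l' > 0" using l' \<open>l > 0\<close> by (cases l') auto
  define D where "D = monom 1 l' - [:b ^ l':]"
  have "poly D b = 0" by (simp add: D_def poly_monom)
  then obtain Q where Q: "D = [:- b, 1:] * Q" by (auto simp: poly_eq_0_iff_dvd elim: dvdE)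
  have "pderiv D = monom (of_nat l') (l' - 1)"
    by (simp add: D_def pderiv_diff pderiv_monom pderiv_pCons)
  moreover have "poly (pderiv D) b = poly Q b" unfolding Q pderiv_mult by (simp add: pderiv_pCons)
  ultimately have "poly Q b = of_nat l' * b ^ (l' - 1)" by (simp add: poly_monom)
  moreover have "of_nat l' \<noteq> (0 :: 'a)"
    using l' by (simp add: of_nat_eq_0_iff_char_dvd p_def)
  ultimately have Qb: "poly Q b \<noteq> 0" using \<open>b \<noteq> 0\<close> by simp
  have "(D + [:b ^ l':]) ^ P = D ^ P + [:b ^ l':] ^ P"
    by (rule freshmans_dream'[where n = "multiplicity p l"]) (use p in \<open>auto simp: P_def p_def\<close>)
  moreover have "[:b ^ l':] ^ P = [:b ^ l:]"
    using l' by (simp add: P_def poly_const_pow mult.commute flip: power_mult)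
  ultimately have "monom 1 l - [:b ^ l:] = D ^ P"
    using l' by (simp add: D_def P_def monom_power mult.commute algebra_simps)
  also have "\<dots> = [:- b, 1:] ^ P * Q ^ P" unfolding Q by (rule power_mult_distrib)
  also have "order b \<dots> = order b ([:- b, 1:] ^ P) + order b (Q ^ P)"
    using Qb by (intro order_mult) auto
  also have "\<dots> = P" using Qb by (simp add: order_power_n_n order_0I)
  finally show ?thesis by (auto simp: P_def p_def)
qed

text \<open>Taking the leftmost minimum in each of two factors isolates a single term of least
  weight in one coefficient of their product, so no cancellation can occur there.\<close>

lemma finite_argmin_leftmost:
  fixes w :: "nat \<Rightarrow> int"
  assumes fin: "finite {i. P i}" and "P k"
  shows "\<exists>i. P i \<and> (\<forall>j. P j \<longrightarrow> w i \<le> w j) \<and> (\<forall>j<i. P j \<longrightarrow> w i < w j)"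
proof -
  define a where "a = Min (w ` {i. P i})"
  have min: "a \<le> w j" if "P j" for j using that fin by (simp add: a_def)
  have "a \<in> w ` {i. P i}" unfolding a_def using assms by (intro Min_in) auto
  then obtain i0 where "P i0 \<and> w i0 = a" by auto
  hence i: "P (LEAST i. P i \<and> w i = a) \<and> w (LEAST i. P i \<and> w i = a) = a" (is "P ?i \<and> _")
    by (rule LeastI)
  have "w ?i < w j" if "j < ?i" "P j" for j
    using not_less_Least[OF that(1)] that(2) min[of j] i by simp
  thus ?thesis using i min by auto
qed

text \<open>
  Dumas' criterion for a Newton polygon with a single edge: giving the coefficient of \<open>x\<^sup>i\<close> the weight
  \<open>m * order b _ - order b A * i\<close>, both ends of the binomial have weight \<open>0\<close>, so both ends of a
  factor must attain the least weight of that factor, which is again \<open>0\<close>.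
\<close>

lemma degree_factor_binomial:
  fixes A B :: "'a::idom poly" and G H :: "'a poly poly"
  assumes F: "monom A m + [:B:] = G * H" and "A \<noteq> 0" and B: "poly B b \<noteq> 0"
    and cop: "coprime (order b A) m" and "m > 0"
  shows "m dvd degree G"
proof -
  define e where "e = order b A"
  define w where "w = (\<lambda>(p :: 'a poly poly) i. int m * int (order b (coeff p i)) - int e * int i)"
  have "B \<noteq> 0" using B by auto
  have coeffF: "coeff (G * H) i = (if i = m then A else if i = 0 then B else 0)" for i
    using \<open>m > 0\<close> by (auto simp flip: F simp: coeff_pCons split: nat.splits)
  have "coeff (G * H) m \<noteq> 0" using coeffF \<open>A \<noteq> 0\<close> by simp
  hence "G * H \<noteq> 0" by (metis coeff_0)
  hence nz: "G \<noteq> 0" "H \<noteq> 0" by auto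
  have supp: "finite {i. coeff p i \<noteq> 0}" for p :: "'a poly poly"
    by (rule finite_subset[of _ "{..degree p}"]) (auto intro: le_degree)
  obtain i where i: "coeff G i \<noteq> 0" "\<And>k. coeff G k \<noteq> 0 \<Longrightarrow> w G i \<le> w G k"
      "\<And>k. coeff G k \<noteq> 0 \<Longrightarrow> k < i \<Longrightarrow> w G i < w G k"
    using finite_argmin_leftmost[OF supp, of G "degree G" "w G"] nz by auto
  obtain j where j: "coeff H j \<noteq> 0" "\<And>k. coeff H k \<noteq> 0 \<Longrightarrow> w H j \<le> w H k"
      "\<And>k. coeff H k \<noteq> 0 \<Longrightarrow> k < j \<Longrightarrow> w H j < w H k"
    using finite_argmin_leftmost[OF supp, of H "degree H" "w H"] nz by auto
  define n where "n = order b (coeff G i * coeff H j)"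
  have n: "n = order b (coeff G i) + order b (coeff H j)"
    unfolding n_def using i j by (intro order_mult) simp
  \<comment> \<open>In every other nonzero term one index lies left of its minimum, so the weight is
    strictly larger. The index sum being fixed, the order at \<open>b\<close> then exceeds
    \<open>n\<close>, and the whole coefficient has order exactly \<open>n\<close>.\<close>
  define R where "R = (\<Sum>k\<in>{..i + j} - {i}. coeff G k * coeff H (i + j - k))"
  have split: "coeff (G * H) (i + j) = coeff G i * coeff H j + R"
    unfolding coeff_mult R_def by (subst sum.remove[of _ i]) auto
  have R: "[:- b, 1:] ^ Suc n dvd R"
    unfolding R_def
  proof (intro dvd_sum)
    fix k assume k: "k \<in> {..i + j} - {i}"
    show "[:- b, 1:] ^ Suc n dvd coeff G k * coeff H (i + j - k)"
    proof (cases "coeff G k * coeff H (i + j - k) = 0")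
      case False
      hence nz': "coeff G k \<noteq> 0" "coeff H (i + j - k) \<noteq> 0" by auto
      have "w G i + w H j < w G k + w H (i + j - k)"
      proof (cases "k < i")
        case True
        thus ?thesis using i(3)[OF nz'(1)] j(2)[OF nz'(2)] by simp
      next
        case False
        hence "i + j - k < j" using k by auto
        thus ?thesis using i(2)[OF nz'(1)] j(3)[OF nz'(2)] by simp
      qed
      moreover have "int e * int k + int e * int (i + j - k) = int e * int i + int e * int j"
        using k by (simp flip: distrib_left of_nat_add)
      ultimately have "int m * int n
          < int m * int (order b (coeff G k) + order b (coeff H (i + j - k)))"
        by (simp add: w_def n algebra_simps)
      hence "n < order b (coeff G k * coeff H (i + j - k))"
        using False by (simp add: order_mult mult_less_cancel_left)
      thus ?thesis by (subst order_divides) simp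
    qed auto
  qed
  have "\<not> [:- b, 1:] ^ Suc n dvd coeff (G * H) (i + j)"
    unfolding split dvd_add_left_iff[OF R] unfolding n_def using i j by (intro order_2) simp
  moreover have "[:- b, 1:] ^ n dvd coeff (G * H) (i + j)"
    unfolding split n_def[symmetric] using order_1[of b "coeff G i * coeff H j"] power_le_dvd[OF R, of n]
    by (intro dvd_add) (auto simp: n_def)
  ultimately have ordF: "order b (coeff (G * H) (i + j)) = n" "coeff (G * H) (i + j) \<noteq> 0"
    by (auto intro: order_unique_lemma)
  \<comment> \<open>The coefficient at \<open>i + j\<close> is nonzero, so it is one of the two ends
    of the binomial.\<close>
  have sum0: "w G i + w H j = 0"
  proof (cases "i + j = m")
    case True
    hence "n = e" using ordF by (simp add: coeffF e_def)
    hence "int m * int n = int e * int (i + j)" using True by simp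
    thus ?thesis by (simp add: w_def n algebra_simps)
  next
    case False
    hence "i + j = 0" using ordF(2) by (auto simp: coeffF split: if_splits)
    moreover have "n = 0" using ordF(1) B False calculation by (simp add: coeffF order_0I)
    ultimately show ?thesis using n by (simp add: w_def)
  qed
  \<comment> \<open>Since \<open>B\<close> does not vanish at \<open>b\<close>, both constant
    coefficients have weight 0. Hence neither minimum is positive, and as they sum to 0 both are
    0.\<close>
  have GH0: "coeff G 0 * coeff H 0 = B" using coeffF[of 0] \<open>m > 0\<close> by (simp add: coeff_mult)
  hence "poly (coeff G 0) b \<noteq> 0" "poly (coeff H 0) b \<noteq> 0" using B by auto
  hence "w G 0 = 0" "w H 0 = 0" "coeff G 0 \<noteq> 0" "coeff H 0 \<noteq> 0" by (auto simp: w_def order_0I)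
  hence wmin: "w G i = 0" "w H j = 0" using i(2)[of 0] j(2)[of 0] sum0 by auto
  have "degree (G * H) = m"
  proof (rule antisym)
    show "degree (G * H) \<le> m" by (rule degree_le) (auto simp: coeffF)
    show "m \<le> degree (G * H)" using \<open>A \<noteq> 0\<close> by (intro le_degree) (simp add: coeffF)
  qed
  hence deg: "degree G + degree H = m" using nz by (simp add: degree_mult_eq)
  hence "lead_coeff G * lead_coeff H = A" 
    using coeffF[of m] coeff_mult_degree_sum[of G H] by simp
  hence e: "e = order b (lead_coeff G) + order b (lead_coeff H)"
    unfolding e_def using \<open>A \<noteq> 0\<close> order_mult by blast
  have "int m * int (order b (lead_coeff G)) + int m * int (order b (lead_coeff H)) = int m * int e"
    by (simp add: e distrib_left)
  moreover have "int e * int (degree G) + int e * int (degree H) = int e * int m"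
    by (simp add: distrib_left flip: deg)
  \<comment> \<open>Neither summand is negative, so each is 0; this equates
    \<open>m * order b (lead_coeff G)\<close> with \<open>e * degree G\<close>.\<close>
  ultimately have "w G (degree G) + w H (degree H) = 0" by (simp add: w_def algebra_simps)
  moreover have "w G (degree G) \<ge> 0" "w H (degree H) \<ge> 0"
    using i(2)[of "degree G"] j(2)[of "degree H"] nz wmin by auto
  ultimately have "int m * int (order b (lead_coeff G)) = int e * int (degree G)"
    by (simp add: w_def)
  hence "m * order b (lead_coeff G) = e * degree G" by (metis of_nat_eq_iff of_nat_mult)
  hence "m dvd e * degree G" by (metis dvd_triv_left)
  thus ?thesis using cop by (simp add: e_def coprime_commute coprime_dvd_mult_right_iff)
qed

text \<open>In a factorization the degrees add up to \<open>m\<close> and are multiples of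
  \<open>m\<close>, so one factor is constant. A constant factor divides both coefficients of the
  binomial and is therefore a unit.\<close>

lemma irreducible_binomial:
  fixes A B :: "'a::idom poly"
  assumes "A \<noteq> 0" and B: "poly B b \<noteq> 0"
    and cop: "coprime (order b A) m" and "m > 0"
    and unit: "\<And>c. c dvd A \<Longrightarrow> c dvd B \<Longrightarrow> c dvd 1"
  shows "Factorial_Ring.irreducible (monom A m + [:B:])"
proof (rule irreducibleI)
  let ?F = "monom A m + [:B:]"
  have coeffF: "coeff ?F m = A" "coeff ?F 0 = B" using \<open>m > 0\<close> by (auto simp: coeff_pCons split: nat.splits)
  have deg: "degree ?F = m"
    using assms by (subst degree_add_eq_left) (auto simp: degree_monom_eq)
  show nz: "?F \<noteq> 0" using coeffF \<open>A \<noteq> 0\<close> by (metis coeff_0)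
  show "\<not> ?F dvd 1" using deg \<open>m > 0\<close> by (auto elim!: is_unit_polyE simp del: add_pCons)
  have const: "G dvd 1" if "?F = G * H" "degree G = 0" for G H
  proof -
    obtain c where c: "G = [:c:]" using \<open>degree G = 0\<close> by (rule degree_eq_zeroE)
    have "coeff ?F i = c * coeff H i" for i by (simp add: that(1) c)
    hence "c dvd A" "c dvd B" using coeffF by (metis dvd_triv_left)+
    thus ?thesis using unit by (simp add: c is_unit_const_poly_iff)
  qed
  fix G H assume F: "?F = G * H"
  have "degree G + degree H = m" using F deg nz by (metis degree_mult_eq mult_eq_0_iff)
  moreover have "m dvd degree G" using degree_factor_binomial[OF F] assms by blast
  ultimately have "degree G = 0 \<or> degree H = 0"
    by (cases "degree G = 0") (auto dest: dvd_imp_le)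
  thus "G dvd 1 \<or> H dvd 1" using const[of G H] const[of H G] F by (auto simp: mult.commute)
qed

section \<open>Passage to the algebraic closure and the form of the curve\<close>

text \<open>The base field already supplies \<open>m\<close> roots of \<open>x ^ m = 1\<close>, the
  most that the closure can have.\<close>

lemma roots_of_unity_alg_closure:
  fixes x :: "'a::finite_field alg_closure"
  assumes mr: "m * r = CARD('a) - 1" and "m > 0" "r > 0" and x: "x ^ m = 1"
  shows "\<exists>u::'a. u \<noteq> 0 \<and> x = to_ac (u ^ r)"
proof -
  let ?R = "{x :: 'a alg_closure. x ^ m = 1}" and ?S = "{x :: 'a. x ^ m = 1}"
  have "to_ac ` ?S \<subseteq> ?R" by (auto simp flip: to_ac_power)
  moreover have "card (to_ac ` ?S) = m"
    using roots_of_unity_finite_field(1)[OF assms(1-3)] card_image[OF inj_on_subset[OF inj_to_ac], of ?S] by simp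
  ultimately have "to_ac ` ?S = ?R"
    using card_power_eq_le[OF \<open>m > 0\<close>, of "1 :: 'a alg_closure"]
    by (intro card_seteq) auto
  hence "x \<in> to_ac ` (\<lambda>u. u ^ r) ` (UNIV - {0})"
    using x roots_of_unity_finite_field(2)[OF assms(1-3)] by auto
  thus ?thesis by auto
qed

definition monom3 :: "'a::zero \<Rightarrow> nat \<Rightarrow> nat \<Rightarrow> nat \<Rightarrow> 'a poly3" where
  "monom3 c i j n = monom (monom (monom c n) j) i"

lemma coeff_monom3:
  "coeff (coeff (coeff (monom3 c i' j' n') i) j) n = (if i = i' \<and> j = j' \<and> n = n' then c else 0)"
  by (simp add: monom3_def)

lemma mult_monom3:
  "monom3 a i j n * monom3 b i' j' n' = monom3 (a * b :: 'a::comm_semiring_1) (i + i') (j + j') (n + n')"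
  by (simp add: monom3_def mult_monom)

lemma map_poly3_monom3: "map_poly3 to_ac (monom3 c i j n) = monom3 (to_ac c) i j n"
  by (simp add: map_poly3_def monom3_def map_poly_monom)

lemma map_poly3_add: "map_poly3 to_ac (F + G) = map_poly3 to_ac F + map_poly3 to_ac G"
  by (intro poly_eqI) (simp add: map_poly3_def coeff_map_poly)

text \<open>The form is expanded into its four monomials so that coefficients, evaluation and base
  change can be computed term by term; \<open>curve_altdef\<close> recovers the original
  shape.\<close>

definition curve :: "'a::comm_ring_1 \<Rightarrow> nat \<Rightarrow> nat \<Rightarrow> 'a poly3" where
  "curve k l m = monom3 (- k) m l 0 + monom3 (- 1) m 0 l + monom3 1 0 m l + monom3 k 0 l m"

lemma curve_eq_binomial:
  "curve k l m = monom (monom (monom (- k) 0) l + monom (monom (- 1) l) 0) m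
     + [:monom (monom 1 l) m + monom (monom k m) l:]"
  by (simp add: curve_def monom3_def monom_0 add_ac flip: add_monom)

lemma x_power_eq_monom: "[:0, 1:] ^ n = monom 1 n"
  by (simp add: monom_altdef)

lemma curve_altdef:
  fixes k :: "'a::comm_ring_1"
  shows "curve k l m = - (const3 k * Y3 ^ l + Z3 ^ l) * X3 ^ m + Z3 ^ l * Y3 ^ m + const3 k * Y3 ^ l * Z3 ^ m"
proof -
  have const: "const3 k = monom3 k 0 0 0" by (simp add: const3_def monom3_def monom_0)
  have X: "(X3 :: 'a poly3) ^ n = monom3 1 n 0 0" for n
    by (simp add: X3_def monom3_def x_power_eq_monom)
  have Y: "(Y3 :: 'a poly3) ^ n = monom3 1 0 n 0" for n
    unfolding Y3_def monom3_def poly_const_pow x_power_eq_monom monom_eq_1 by (rule monom_0[symmetric])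
  have Z: "(Z3 :: 'a poly3) ^ n = monom3 1 0 0 n" for n
    unfolding Z3_def monom3_def poly_const_pow x_power_eq_monom by (simp add: monom_0)
  have uminus: "- monom3 c i j n = monom3 (- c) i j n" for c :: 'a and i j n
    by (simp add: monom3_def minus_monom)
  show ?thesis
    unfolding curve_def const X Y Z minus_add_distrib distrib_right mult_minus_left mult_monom3 uminus
    by simp
qed

lemma eval3_curve:
  "eval3 (curve k l m) x y z = - (k * y ^ l + z ^ l) * x ^ m + z ^ l * y ^ m + k * y ^ l * z ^ m"
  by (simp add: eval3_def curve_def monom3_def poly_monom algebra_simps)

lemma coeff_curve:
  "coeff (coeff (coeff (curve k l m) i) j) n
     = (if i = m \<and> j = l \<and> n = 0 then - k else 0) + (if i = m \<and> j = 0 \<and> n = l then - 1 else 0)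
     + (if i = 0 \<and> j = m \<and> n = l then 1 else 0) + (if i = 0 \<and> j = l \<and> n = m then k else 0)"
  by (simp only: curve_def coeff_add coeff_monom3)

lemma plane_curve_curve:
  assumes "k \<noteq> 0" "l > 0" "m > 0"
  shows "plane_curve (curve k l m)"
proof -
  have "coeff (coeff (coeff (curve k l m) m) l) 0 = - k" using assms by (simp add: coeff_curve)
  hence "curve k l m \<noteq> 0" using assms by (metis coeff_0 neg_equal_0_iff_equal)
  moreover have "homogeneous3 (curve k l m)"
    unfolding homogeneous3_def by (intro exI[of _ "l + m"]) (auto simp: coeff_curve split: if_splits)
  ultimately show ?thesis by (simp add: plane_curve_def)
qed

lemma map_poly3_curve: "map_poly3 to_ac (curve k l m) = curve (to_ac k) l m"
  by (simp add: curve_def map_poly3_add map_poly3_monom3)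

section \<open>Irreducibility of the curve over an algebraically closed field\<close>

lemma poly_map_poly_eval: "poly (map_poly (\<lambda>p. poly p z) c) y = poly (poly c [:y:]) z"
  for c :: "'a::comm_ring_1 poly poly"
  by (induction c) (simp_all add: map_poly_pCons)

text \<open>Dehomogenize at \<open>z = 1\<close>. The leading coefficient of \<open>c\<close> in
  \<open>y\<close> divides a unit, hence is a nonzero constant, and the degree of \<open>c\<close>
  in \<open>y\<close> survives. If it were positive, a root would give a common zero of
  \<open>A\<close> and \<open>B\<close>.\<close>

lemma is_unit_common_divisor:
  fixes A B c :: "'a::alg_closed_field poly poly"
  assumes lead: "lead_coeff A dvd 1" and dvd: "c dvd A" "c dvd B"
    and coprime: "\<And>t. poly (poly A [:t:]) 1 = 0 \<Longrightarrow> poly (poly B [:t:]) 1 \<noteq> 0"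
  shows "c dvd 1"
proof -
  have "lead_coeff c dvd lead_coeff A"
    using dvd(1) by (auto simp: lead_coeff_mult elim!: dvdE)
  hence "lead_coeff c dvd 1" using lead dvd_trans by blast
  then obtain u where u: "lead_coeff c = monom u 0" "u \<noteq> 0" by (rule is_unit_polyE')
  show ?thesis
  proof (cases "degree c = 0")
    case True
    then obtain d where "c = [:d:]" by (rule degree_eq_zeroE)
    with \<open>lead_coeff c dvd 1\<close> show ?thesis by (simp add: is_unit_const_poly_iff)
  next
    case False
    let ?c = "map_poly (\<lambda>p. poly p 1) c"
    have "coeff ?c (degree c) \<noteq> 0" using u by (simp add: coeff_map_poly poly_monom)
    hence "degree ?c > 0" using le_degree False by fastforce
    then obtain t where "poly ?c t = 0" using alg_closed_imp_poly_has_root by blast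
    hence "poly (poly c [:t:]) 1 = 0" by (simp add: poly_map_poly_eval)
    hence "poly (poly A [:t:]) 1 = 0" "poly (poly B [:t:]) 1 = 0" using dvd by (auto elim!: dvdE)
    with coprime show ?thesis by blast
  qed
qed

lemma irreducible_curve:
  fixes k :: "'a::alg_closed_field"
  assumes p: "prime CHAR('a)" and "k \<noteq> 0" "l > 0" "m > 0" and cop: "coprime CHAR('a) m"
    and no_root: "\<And>x. x ^ m = 1 \<Longrightarrow> k * x ^ l \<noteq> - 1"
  shows "Factorial_Ring.irreducible (curve k l m)"
proof -
  define A where "A = monom (monom (- k) 0) l + monom (monom (- 1) l) 0"
  define B where "B = monom (monom 1 l) m + monom (monom k m) l"
  have "degree (monom k l + [:1:]) = l"
    using assms by (subst degree_add_eq_left) (auto simp: degree_monom_eq)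
  hence "degree (monom k l + [:1:]) > 0" using \<open>l > 0\<close> by simp
  then obtain x where "poly (monom k l + [:1:]) x = 0" using alg_closed_imp_poly_has_root by blast
  hence x: "k * x ^ l = - 1" by (simp add: poly_monom add_eq_0_iff2)
  hence "x \<noteq> 0" using \<open>l > 0\<close> by (auto simp: power_0_left)
  \<comment> \<open>This is \<open>x * z\<close> in the coefficient ring of polynomials in
    \<open>z\<close>; by \<open>k * x ^ l = - 1\<close> it is a root of \<open>A\<close> in
    \<open>y\<close>.\<close>
  define b where "b = monom x 1"
  have b: "b \<noteq> 0" "b ^ n = monom (x ^ n) n" for n
    using \<open>x \<noteq> 0\<close> by (auto simp: b_def monom_power)
  have A: "A = smult [:- k:] (monom 1 l - [:b ^ l:])"
    using x by (simp add: A_def b smult_monom smult_diff_right monom_0 minus_monom)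
  obtain n where "order b (monom 1 l - [:b ^ l:]) = CHAR('a) ^ n"
    using order_power_minus_power[of l b] p \<open>l > 0\<close> b(1) by auto
  hence ord: "order b A = CHAR('a) ^ n" unfolding A using \<open>k \<noteq> 0\<close> by (simp add: order_smult)
  have lead: "degree A = l" "lead_coeff A = [:- k:]"
  proof -
    show "degree A = l" unfolding A_def
      using assms by (subst degree_add_eq_left) (auto simp: degree_monom_eq)
    thus "lead_coeff A = [:- k:]" 
      using \<open>l > 0\<close> by (simp add: A_def monom_0 coeff_pCons split: nat.splits)
  qed
  have "Factorial_Ring.irreducible (monom A m + [:B:])"
  proof (rule irreducible_binomial[where b = b])
    show "A \<noteq> 0" using lead \<open>k \<noteq> 0\<close> by auto
    \<comment> \<open>The coefficient equals \<open>x ^ m - 1\<close>, which is nonzero because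
      \<open>x\<close> violates the conclusion of \<open>no_root\<close>.\<close>
    have "poly B b = monom (x ^ m + k * x ^ l) (l + m)"
      by (simp add: B_def poly_monom b mult_monom add_monom add.commute)
    moreover have "x ^ m + k * x ^ l \<noteq> 0" using x no_root[of x] by auto
    ultimately show "poly B b \<noteq> 0" by simp
    show "coprime (order b A) m" unfolding ord using cop by simp
    fix c assume "c dvd A" "c dvd B"
    thus "c dvd 1"
    proof (rule is_unit_common_divisor[rotated])
      show "lead_coeff A dvd 1"
        using lead \<open>k \<noteq> 0\<close> by (simp add: is_unit_const_poly_iff dvd_field_iff)
      fix t assume "poly (poly A [:t:]) 1 = 0"
      hence t: "k * t ^ l = - 1" by (simp add: A_def poly_monom algebra_simps add_eq_0_iff2)
      with no_root have "t ^ m \<noteq> 1" by blast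
      thus "poly (poly B [:t:]) 1 \<noteq> 0" using t by (simp add: B_def poly_monom)
    qed
  qed fact
  thus ?thesis by (simp add: curve_eq_binomial A_def B_def)
qed

section \<open>Rational points of the curve and lines\<close>

lemma proj_pt_in_proj_line:
  "(x, y, z) \<noteq> (0, 0, 0) \<Longrightarrow> a * x + b * y + c * z = 0 \<Longrightarrow> proj_pt x y z \<in> proj_line a b c"
  unfolding proj_line_def by blast

lemma proj_pt_in_rational_points:
  "(x, y, z) \<noteq> (0, 0, 0) \<Longrightarrow> eval3 F x y z = 0 \<Longrightarrow> proj_pt x y z \<in> rational_points F"
  unfolding rational_points_def by blast

lemma rational_points_subset: "rational_points F \<subseteq> proj_plane"
  by (auto simp: rational_points_def proj_plane_def proj_pt_def intro!: quotientI)

lemma proj_pt_eqD: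
  assumes "proj_pt x y z = proj_pt x' y' z'" and "(x', y', z') \<noteq> (0, 0, 0)"
  shows "\<exists>c. c \<noteq> 0 \<and> x' = c * x \<and> y' = c * y \<and> z' = c * z"
proof -
  have "(x', y', z') \<in> proj_pt x' y' z'"
    using assms(2) by (auto simp: proj_pt_def proj_rel_def intro: exI[of _ 1])
  hence "(x', y', z') \<in> proj_pt x y z" using assms(1) by simp
  thus ?thesis by (auto simp: proj_pt_def proj_rel_def)
qed

text \<open>Homogeneity of degree \<open>l + m\<close> makes vanishing independent of the
  representative.\<close>

lemma proj_pt_in_rational_points_curve:
  assumes "proj_pt x y z \<in> rational_points (curve k l m)"
  shows "eval3 (curve k l m) x y z = 0"
proof -
  obtain x' y' z' where P: "proj_pt x y z = proj_pt x' y' z'" "(x', y', z') \<noteq> (0, 0, 0)"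
      "eval3 (curve k l m) x' y' z' = 0"
    using assms unfolding rational_points_def by blast
  obtain c where c: "c \<noteq> 0" "x' = c * x" "y' = c * y" "z' = c * z" using proj_pt_eqD[OF P(1,2)] by blast
  have "eval3 (curve k l m) x' y' z' = c ^ (l + m) * eval3 (curve k l m) x y z"
    by (simp add: c eval3_curve power_mult_distrib power_add algebra_simps)
  with P(3) c(1) show ?thesis by simp
qed

lemma blocking_curve:
  fixes k :: "'a::finite_field"
  assumes r: "r \<ge> 2" and q: "CARD('a) > r ^ 4" and mr: "m * r = CARD('a) - 1" and "m > 0" "l > 0"
  shows "blocking_set (rational_points (curve k l m))"
  unfolding blocking_set_def
proof (intro conjI ballI rational_points_subset)
  fix L :: "'a proj_point set" assume "L \<in> proj_lines"
  then obtain a b c where abc: "(a, b, c) \<noteq> (0, 0, 0)" and L: "L = proj_line a b c"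
    by (auto simp: proj_lines_def)
  have "\<exists>x y z. (x, y, z) \<noteq> (0, 0, 0) \<and> a * x + b * y + c * z = 0 \<and> eval3 (curve k l m) x y z = 0"
  \<comment> \<open>Every monomial of the form involves two variables, so the three coordinate
    points lie on the curve. When all \<open>m\<close>-th powers are 1, the remaining terms cancel
    in pairs.\<close>
  proof (cases "a = 0 \<or> b = 0 \<or> c = 0")
    case True
    thus ?thesis
    proof (elim disjE)
      assume "a = 0"
      show ?thesis
        by (rule exI[of _ 1], rule exI[of _ 0], rule exI[of _ 0])
          (use assms \<open>a = 0\<close> in \<open>simp add: eval3_curve power_0_left\<close>)
    next
      assume "b = 0"
      show ?thesis
        by (rule exI[of _ 0], rule exI[of _ 1], rule exI[of _ 0])
          (use assms \<open>b = 0\<close> in \<open>simp add: eval3_curve power_0_left\<close>)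
    next
      assume "c = 0"
      show ?thesis
        by (rule exI[of _ 0], rule exI[of _ 0], rule exI[of _ 1])
          (use assms \<open>c = 0\<close> in \<open>simp add: eval3_curve power_0_left\<close>)
    qed
  next
    case False
    have card: "card {x::'a. x ^ m = 1} = m"
      using roots_of_unity_finite_field(1)[OF mr] assms by simp
    have "CARD('a) = m * r + 1" using mr zero_less_card_finite[where 'a = 'a] by simp
    hence "real CARD('a) * (real CARD('a) - real m)\<^sup>2 < real m ^ 4"
      using subgroup_size_estimate r q by blast
    hence "\<exists>x\<in>{x. x ^ m = 1}. \<exists>y\<in>{x. x ^ m = 1}. \<exists>z\<in>{x. x ^ m = 1}. a * x + b * y + c * z = 0"
      using False \<open>m > 0\<close> by (intro diagonal_form_zero_in_subsemigroup)
        (auto simp: card power_mult_distrib power_0_left)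
    then obtain x y z where "x ^ m = 1" "y ^ m = 1" "z ^ m = 1" "a * x + b * y + c * z = 0" by auto
    moreover have "x \<noteq> 0" using \<open>x ^ m = 1\<close> \<open>m > 0\<close> by (auto simp: power_0_left)
    ultimately show ?thesis by (intro exI[of _ x] exI[of _ y] exI[of _ z]) (simp add: eval3_curve)
  qed
  then obtain x y z where "(x, y, z) \<noteq> (0, 0, 0)" "a * x + b * y + c * z = 0" "eval3 (curve k l m) x y z = 0"
    by blast
  hence "proj_pt x y z \<in> L \<inter> rational_points (curve k l m)"
    unfolding L by (intro IntI proj_pt_in_proj_line proj_pt_in_rational_points)
  thus "L \<inter> rational_points (curve k l m) \<noteq> {}" by blast
qed

lemma no_line_in_curve:
  fixes k :: "'a::finite_field"
  assumes "k \<noteq> 0" "m > 0" "l > 0" "L \<in> proj_lines"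
    and no_root: "\<And>x. x ^ m = 1 \<Longrightarrow> - k \<noteq> x ^ l"
  shows "\<not> L \<subseteq> rational_points (curve k l m)"
proof
  assume sub: "L \<subseteq> rational_points (curve k l m)"
  obtain a b c where abc: "(a, b, c) \<noteq> (0, 0, 0)" and L: "L = proj_line a b c"
    using assms(4) by (auto simp: proj_lines_def)
  have on: "- (k * y ^ l + z ^ l) * x ^ m + z ^ l * y ^ m + k * y ^ l * z ^ m = 0"
    if "(x, y, z) \<noteq> (0, 0, 0)" "a * x + b * y + c * z = 0" for x y z
  proof -
    have "proj_pt x y z \<in> rational_points (curve k l m)"
      using proj_pt_in_proj_line[OF that] sub by (auto simp: L)
    thus ?thesis using proj_pt_in_rational_points_curve eval3_curve by metis
  qed
  have simps: "(0 :: 'a) ^ m = 0" "(0 :: 'a) ^ l = 0" "k \<noteq> 0" using assms by auto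
  have k1: "1 + k \<noteq> 0" using no_root[of 1] by (auto simp: add_eq_0_iff)
  \<comment> \<open>In the first five cases a single point of the line leaves one nonzero monomial,
    or the value \<open>1 + k\<close> at the point with coordinates 0, 1, 1.\<close>
  consider "a \<noteq> 0" "c \<noteq> 0" | "a \<noteq> 0" "b \<noteq> 0" | "a \<noteq> 0" "b = 0" "c = 0"
    | "a = 0" "b = 0" | "a = 0" "c = 0" | "a = 0" "b \<noteq> 0" "c \<noteq> 0" by blast
  thus False
  proof cases
    case 1 thus False using on[of c 0 "- a"] by (simp add: simps)
  next
    case 2 thus False using on[of b "- a" 0] by (simp add: simps)
  next
    case 3 thus False using on[of 0 1 1] k1 by (simp add: simps)
  next
    case 4 thus False using on[of 1 1 0] by (simp add: simps)
  next
    case 5 thus False using on[of 1 0 1] by (simp add: simps)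
  next
    case 6
    \<comment> \<open>Comparing the points with \<open>x = 0\<close> and \<open>x = 1\<close>
      separates the coefficient of \<open>x ^ m\<close> from the rest. Together they make
      \<open>- b / c\<close> an \<open>m\<close>-th root of unity with \<open>l\<close>-th power
      \<open>- k\<close>.\<close>
    have "(- b) ^ l * c ^ m + k * c ^ l * (- b) ^ m = 0" using on[of 0 c "- b"] 6 by (simp add: simps)
    moreover have "k * c ^ l + (- b) ^ l = 0" using on[of 1 c "- b"] 6 calculation by (simp add: algebra_simps)
    hence eq: "(- b) ^ l = - k * c ^ l" by (simp add: add_eq_0_iff)
    ultimately have "k * c ^ l * ((- b) ^ m - c ^ m) = 0" by (simp add: algebra_simps)
    hence "(- b) ^ m = c ^ m" using 6 \<open>k \<noteq> 0\<close> by simp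
    hence "(- b / c) ^ m = 1" unfolding power_divide using 6 by simp
    moreover have "(- b / c) ^ l = - k" unfolding power_divide eq using 6 by simp
    ultimately show False using no_root[of "- b / c"] by simp
  qed
qed

theorem theorem6p2:
  fixes r q m l :: nat
    and k :: "'a::finite_field"
    and C :: "'a poly3"
  assumes "r \<ge> 2"
    and "q = CARD('a)"
    and "[q = 1] (mod r)"
    and "q > r ^ 4"
    and "k \<noteq> 0"
    and "\<not> (\<exists>c::'a. c \<noteq> 0 \<and> - k = c ^ r)"
    and "m = (q - 1) div r"
    and "l \<ge> 1"
    and "C = - (const3 k * Y3 ^ l + Z3 ^ l) * X3 ^ m + Z3 ^ l * Y3 ^ m + const3 k * Y3 ^ l * Z3 ^ m"
  shows "plane_curve C \<and> geometrically_irreducible C \<and> nontrivially_blocking C"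
proof -
  have C: "C = curve k l m" using assms(9) by (simp only: curve_altdef)
  have "q > 0" by (simp add: assms(2))
  hence "r dvd q - 1" using assms(3) by (simp add: cong_altdef_nat cong_sym_eq)
  hence mr: "m * r = CARD('a) - 1" using assms(2,7) by simp
  have "q > 1" using assms(1,4) by (meson le_less_trans one_le_power one_le_numeral order_trans)
  hence "m > 0" using mr assms(2) by (cases m) auto
  have pos: "r > 0" "l > 0" using assms by auto
  \<comment> \<open>Such an \<open>x\<close> is a nonzero \<open>r\<close>-th power, hence so is
    \<open>x ^ l\<close>.\<close>
  have no_root: "- k \<noteq> x ^ l" if x: "x ^ m = 1" for x :: 'a
  proof
    assume k: "- k = x ^ l"
    obtain u where "u \<noteq> 0" "x = u ^ r"
      using roots_of_unity_finite_field(2)[OF mr \<open>m > 0\<close> \<open>r > 0\<close>] x by auto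
    hence "u ^ l \<noteq> 0 \<and> - k = (u ^ l) ^ r" by (simp add: k mult.commute flip: power_mult)
    thus False using assms(6) by blast
  qed
  have "coprime CHAR('a) m"
  proof (rule prime_imp_coprime)
    \<comment> \<open>The characteristic divides \<open>q\<close>, while \<open>m\<close> divides
      \<open>q - 1\<close>.\<close>
    show "\<not> CHAR('a) dvd m"
    proof
      assume "CHAR('a) dvd m"
      hence "CHAR('a) dvd CARD('a) - 1" unfolding mr[symmetric] by simp
      with CHAR_dvd_CARD[where 'a = 'a] have "CHAR('a) dvd 1"
        by (metis \<open>q > 0\<close> assms(2) dvd_diffD1 Suc_leI One_nat_def)
      thus False using CHAR_prime[where 'a = 'a] by (metis not_prime_unit)
    qed
  qed simp
  moreover have "to_ac k * x ^ l \<noteq> - 1" if x: "x ^ m = 1" for x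
  proof
    assume k: "to_ac k * x ^ l = - 1"
    obtain u :: 'a where u: "u \<noteq> 0" "x = to_ac (u ^ r)"
      using roots_of_unity_alg_closure[OF mr \<open>m > 0\<close> \<open>r > 0\<close> x] by blast
    have "to_ac (k * (u ^ r) ^ l) = to_ac (- 1)" using k u by simp
    hence "k * (u ^ r) ^ l = - 1" by (simp only: to_ac_eq_iff)
    \<comment> \<open>Inverting the root of unity moves it to the other side, in the form excluded
      by \<open>no_root\<close>.\<close>
    hence "- k = (inverse u ^ r) ^ l" using u
      by (simp add: field_simps power_inverse[symmetric])
    moreover have "(inverse u ^ r) ^ m = 1"
      using u nonzero_power_card_minus_1[of "inverse u"] by (simp add: mr mult.commute flip: power_mult)
    ultimately show False using no_root by blast
  qed
  ultimately have "geometrically_irreducible C"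
    unfolding geometrically_irreducible_def C map_poly3_curve
    using assms(5) pos \<open>m > 0\<close> by (intro irreducible_curve) auto
  moreover have "nontrivially_blocking C"
    unfolding nontrivially_blocking_def nontrivial_blocking_set_def C
  proof (intro conjI ballI)
    show "blocking_set (rational_points (curve k l m))"
      using assms(1,2,4) mr \<open>m > 0\<close> pos by (intro blocking_curve) auto
    show "\<not> L \<subseteq> rational_points (curve k l m)" if "L \<in> proj_lines" for L
      using assms(5) \<open>m > 0\<close> pos that no_root by (intro no_line_in_curve)
  qed
  moreover have "plane_curve C"
    unfolding C using assms(5) pos \<open>m > 0\<close> by (intro plane_curve_curve)
  ultimately show ?thesis by blast
qed

end
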